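(* If a pseudocompact space $X$ admits a separately continuous transitive $s$-action of an $\omega$-narrow semitopological group, then $X$ is skeletally Dugundji.
   Context: All spaces are Tychonoff (including the underlying spaces of groups). A semitopological group is a group $G$ with a topology making the multiplication $G\times G\to G$ separately continuous. It is $\omega$-narrow if for every neighborhood $U$ of the neutral element there is a countable set $A\subset G$ with $UA=AU=G$. Actions are left actions $\theta:G\times X\to X$, written $\theta(g,x)=gx$; an action is separately continuous if $\theta$ is separately continuous, and transitive if for every $x\in X$ the map $\theta^x:G\to X$, $\theta^x(g)=gx$, is surjective. A separately continuous action $\theta$ of $G$ on $X$ generates a right action $\Theta:G\times C(X)\to C(X)$, $\Theta(g,f)(x)=f(gx)$, where $C(X)$ is the set of continuous real-valued functions on $X$; $C_p(X)$ denotes $C(X)$ with the topology of pointwise convergence. The action $\theta$ is an $s$-action if every orbit $\{\Theta(g,f):g\in G\}$, $f\in C(X)$, is a separable subset of $C_p(X)$. A continuous map $f:X\to Y$ is skeletal if $\operatorname{Int}\overline{f(U)}\neq\varnothing$ for every nonempty open $U\subset X$ (closure and interior in $Y$). A space $X$ is skeletally Dugundji if there is a well-ordered inverse system $S=\{X_\alpha,p^\beta_\alpha,\alpha<\beta<\tau\}$, $\tau$ a cardinal (indices are ordinals below $\tau$), with surjective skeletal bonding maps $p^\beta_\alpha:X_\beta\to X_\alpha$, such that: (i) $X_0$ is separable metrizable and every $p^{\alpha+1}_\alpha$ has a metrizable kernel, i.e. there is a separable metrizable space $M_\alpha$ such that $X_{\alpha+1}$ is embedded in $X_\alpha\times M_\alpha$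 and $p^{\alpha+1}_\alpha$ is the restriction to $X_{\alpha+1}$ of the projection $X_\alpha\times M_\alpha\to X_\alpha$; (ii) for every (nonzero) limit ordinal $\gamma<\tau$, $X_\gamma$ is a (dense) subspace of $\varprojlim\{X_\alpha,p^\beta_\alpha,\alpha<\beta<\gamma\}$ (via the natural map induced by the $p^\gamma_\alpha$); (iii) $X$ is embedded in $\varprojlim S$ so that $p_\alpha(X)=X_\alpha$ for each $\alpha$, where $p_\alpha:\varprojlim S\to X_\alpha$ is the limit projection; (iv) for every bounded continuous real-valued function $f$ on $\varprojlim S$ there are $\alpha<\tau$ and a continuous function $g$ on $X_\alpha$ with $f=g\circ p_\alpha$. *)

theory Defs
  imports "HOL-Analysis.Analysis" "HOL-Algebra.Group_Action"
begin

definition Tychonoff_space :: "'a topology \<Rightarrow> bool" where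
  "Tychonoff_space X \<longleftrightarrow> completely_regular_space X \<and> Hausdorff_space X"

definition pseudocompact_space :: "'a topology \<Rightarrow> bool" where
  "pseudocompact_space X \<longleftrightarrow>
     (\<forall>f. continuous_map X euclideanreal f \<longrightarrow> bounded (f ` topspace X))"

locale semitopological_group = group G for G :: "('g, 'm) monoid_scheme" (structure) +
  fixes T :: "'g topology"
  assumes topspace_eq: "topspace T = carrier G"
    and continuous_left: "a \<in> carrier G \<Longrightarrow> continuous_map T T (\<lambda>x. a \<otimes> x)"
    and continuous_right: "a \<in> carrier G \<Longrightarrow> continuous_map T T (\<lambda>x. x \<otimes> a)"

definition omega_narrow :: "('g, 'm) monoid_scheme \<Rightarrow> 'g topology \<Rightarrow> bool" where
  "omega_narrow G T \<longleftrightarrow>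
     (\<forall>U \<subseteq> carrier G. (\<exists>V. openin T V \<and> \<one>\<^bsub>G\<^esub> \<in> V \<and> V \<subseteq> U) \<longrightarrow>
        (\<exists>A \<subseteq> carrier G. countable A \<and>
           U <#>\<^bsub>G\<^esub> A = carrier G \<and> A <#>\<^bsub>G\<^esub> U = carrier G))"

definition separately_continuous_action ::
    "('g, 'm) monoid_scheme \<Rightarrow> 'g topology \<Rightarrow> 'a topology \<Rightarrow> ('g \<Rightarrow> 'a \<Rightarrow> 'a) \<Rightarrow> bool" where
  "separately_continuous_action G T X \<theta> \<longleftrightarrow>
     group_action G (topspace X) \<theta> \<and>
     (\<forall>g\<in>carrier G. continuous_map X X (\<theta> g)) \<and>
     (\<forall>x\<in>topspace X. continuous_map T X (\<lambda>g. \<theta> g x))"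

text \<open>Functions on a space are represented extensionally, so that functions with the same
  values on the carrier are identified.\<close>

definition Cp :: "'a topology \<Rightarrow> ('a \<Rightarrow> real) topology" where
  "Cp X = subtopology (product_topology (\<lambda>_. euclideanreal) (topspace X))
            {f. continuous_map X euclideanreal f}"

definition right_action :: "'a topology \<Rightarrow> ('g \<Rightarrow> 'a \<Rightarrow> 'a) \<Rightarrow> 'g \<Rightarrow> ('a \<Rightarrow> real) \<Rightarrow> 'a \<Rightarrow> real" where
  "right_action X \<theta> g f = (\<lambda>x\<in>topspace X. f (\<theta> g x))"

definition s_action ::
    "('g, 'm) monoid_scheme \<Rightarrow> 'a topology \<Rightarrow> ('g \<Rightarrow> 'a \<Rightarrow> 'a) \<Rightarrow> bool" where
  "s_action G X \<theta> \<longleftrightarrow>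
     (\<forall>f\<in>topspace (Cp X).
        separable_space (subtopology (Cp X) ((\<lambda>g. right_action X \<theta> g f) ` carrier G)))"

definition skeletal_map :: "'a topology \<Rightarrow> 'b topology \<Rightarrow> ('a \<Rightarrow> 'b) \<Rightarrow> bool" where
  "skeletal_map X Y f \<longleftrightarrow> continuous_map X Y f \<and>
     (\<forall>U. openin X U \<and> U \<noteq> {} \<longrightarrow> Y interior_of (Y closure_of (f ` U)) \<noteq> {})"

text \<open>Every separable metrizable space embeds into the countable power of the real line, so
  restricting the second factor to the type \<^typ>\<open>nat \<Rightarrow> real\<close> is no loss of generality.\<close>

definition metrizable_kernel :: "'a topology \<Rightarrow> 'b topology \<Rightarrow> ('a \<Rightarrow> 'b) \<Rightarrow> bool" where
  "metrizable_kernel Y X p \<longleftrightarrow>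
     (\<exists>(M :: (nat \<Rightarrow> real) topology) e.
        metrizable_space M \<and> separable_space M \<and>
        embedding_map Y (prod_topology X M) e \<and> (\<forall>y\<in>topspace Y. fst (e y) = p y))"

text \<open>Ordinals below a cardinal are modelled by the field of a cardinal order \<open>r\<close>;
  \<open>underS r \<beta>\<close> is the set of indices strictly below \<open>\<beta>\<close>, and \<open>p \<alpha> \<beta>\<close> is the bonding
  map from \<open>X \<beta>\<close> to \<open>X \<alpha>\<close>.\<close>

definition is_successor :: "'i rel \<Rightarrow> 'i \<Rightarrow> 'i \<Rightarrow> bool" where
  "is_successor r \<alpha> \<beta> \<longleftrightarrow> \<alpha> \<in> underS r \<beta> \<and> (\<forall>\<gamma>\<in>underS r \<beta>. (\<gamma>, \<alpha>) \<in> r)"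

definition is_limit :: "'i rel \<Rightarrow> 'i \<Rightarrow> bool" where
  "is_limit r \<gamma> \<longleftrightarrow> \<gamma> \<in> Field r \<and> underS r \<gamma> \<noteq> {} \<and> \<not> (\<exists>\<alpha>. is_successor r \<alpha> \<gamma>)"

definition inverse_system ::
    "'i rel \<Rightarrow> ('i \<Rightarrow> 'a topology) \<Rightarrow> ('i \<Rightarrow> 'i \<Rightarrow> 'a \<Rightarrow> 'a) \<Rightarrow> bool" where
  "inverse_system r X p \<longleftrightarrow>
     (\<forall>\<alpha>\<in>Field r. Tychonoff_space (X \<alpha>)) \<and>
     (\<forall>\<beta>\<in>Field r. \<forall>\<alpha>\<in>underS r \<beta>. continuous_map (X \<beta>) (X \<alpha>) (p \<alpha> \<beta>)) \<and>
     (\<forall>\<gamma>\<in>Field r. \<forall>\<beta>\<in>underS r \<gamma>. \<forall>\<alpha>\<in>underS r \<beta>. \<forall>x\<in>topspace (X \<gamma>).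
        p \<alpha> \<gamma> x = p \<alpha> \<beta> (p \<beta> \<gamma> x))"

definition inverse_limit ::
    "'i rel \<Rightarrow> 'i set \<Rightarrow> ('i \<Rightarrow> 'a topology) \<Rightarrow> ('i \<Rightarrow> 'i \<Rightarrow> 'a \<Rightarrow> 'a) \<Rightarrow> ('i \<Rightarrow> 'a) topology" where
  "inverse_limit r I X p = subtopology (product_topology X I)
     {x. \<forall>\<beta>\<in>I. \<forall>\<alpha>\<in>I \<inter> underS r \<beta>. p \<alpha> \<beta> (x \<beta>) = x \<alpha>}"

definition skeletally_Dugundji_system ::
    "'x topology \<Rightarrow> 'i rel \<Rightarrow> ('i \<Rightarrow> 'a topology) \<Rightarrow> ('i \<Rightarrow> 'i \<Rightarrow> 'a \<Rightarrow> 'a) \<Rightarrow> bool" where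
  "skeletally_Dugundji_system X r S p \<longleftrightarrow>
     Card_order r \<and> Field r \<noteq> {} \<and> inverse_system r S p \<and>
     (\<forall>\<beta>\<in>Field r. \<forall>\<alpha>\<in>underS r \<beta>.
        p \<alpha> \<beta> ` topspace (S \<beta>) = topspace (S \<alpha>) \<and> skeletal_map (S \<beta>) (S \<alpha>) (p \<alpha> \<beta>)) \<and>
     (\<forall>\<alpha>\<in>Field r. underS r \<alpha> = {} \<longrightarrow> metrizable_space (S \<alpha>) \<and> separable_space (S \<alpha>)) \<and>
     (\<forall>\<alpha> \<beta>. is_successor r \<alpha> \<beta> \<longrightarrow> metrizable_kernel (S \<beta>) (S \<alpha>) (p \<alpha> \<beta>)) \<and>
     (\<forall>\<gamma>. is_limit r \<gamma> \<longrightarrow>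
        (let L = inverse_limit r (underS r \<gamma>) S p;
             h = (\<lambda>x. \<lambda>\<alpha>\<in>underS r \<gamma>. p \<alpha> \<gamma> x)
         in embedding_map (S \<gamma>) L h \<and> L closure_of (h ` topspace (S \<gamma>)) = topspace L)) \<and>
     (let L = inverse_limit r (Field r) S p
      in (\<exists>e. embedding_map X L e \<and>
             (\<forall>\<alpha>\<in>Field r. (\<lambda>x. e x \<alpha>) ` topspace X = topspace (S \<alpha>))) \<and>
         (\<forall>f. continuous_map L euclideanreal f \<and> bounded (f ` topspace L) \<longrightarrow>
            (\<exists>\<alpha>\<in>Field r. \<exists>g. continuous_map (S \<alpha>) euclideanreal g \<and>
               (\<forall>x\<in>topspace L. f x = g (x \<alpha>)))))"

text \<open>The spaces \<open>S \<alpha>\<close> are images of \<open>X\<close>, so up to homeomorphism they live on the type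
  of \<open>X\<close>. The type of indices bounds the cardinal, again without loss of generality. In a system
  of arbitrary length, the topologies induced on \<open>X\<close> by the \<open>S \<alpha>\<close> increase, and keeping one
  index for each of the at most \<open>2^|X| + 1\<close> distinct ones yields an equivalent system. It can
  be prolonged to length the cardinal successor of \<open>|X \<Rightarrow> real|\<close> by constantly
  adding \<open>X\<close> at the end: \<open>X\<close> is a dense subspace of the limit, and the limit projections are
  skeletal on \<open>X\<close>.\<close>

definition skeletally_Dugundji :: "'a topology \<Rightarrow> bool" where
  "skeletally_Dugundji X \<longleftrightarrow>
     (\<exists>(r :: ('a \<Rightarrow> real) set rel) (S :: ('a \<Rightarrow> real) set \<Rightarrow> 'a topology) p.
        skeletally_Dugundji_system X r S p)"

end

theory Submission
  imports Defs
begin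

text \<open>
  The space \<open>X\<close> is built up through quotients, each of which is obtained by identifying the
  points that a family \<open>F \<alpha>\<close> of continuous real functions does not distinguish. Enumerate all
  continuous functions on \<open>X\<close> along an infinite cardinal and let \<open>F \<alpha>\<close> consist of the orbits
  under the group of those that come before \<open>\<alpha>\<close>. The initial quotient has at most one point, the
  quotients at limit stages embed densely in the limits of the preceding ones, and since every
  continuous function is eventually listed, \<open>X\<close> embeds densely in the limit of the whole system
  and every continuous function on that limit factors through one stage. This is the content of
  \<open>skeletally_Dugundji_system_S\<close>, which leaves two things to the group: that the projections are
  skeletal, and that each successor stage has a metrizable kernel.

  For the first, each family \<open>F \<alpha>\<close> is invariant, so the group still acts on the quotient, by
  homeomorphisms. By transitivity and narrowness, countably many translates of a nonempty open
  subset of \<open>X\<close> cover \<open>X\<close>, so countably many translates of the closure of its image cover the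
  quotient. The quotient is pseudocompact, hence a Baire space (\<open>pseudocompact_space_Baire\<close>), and
  therefore this closure has interior points (\<open>skeletal_map_rep\<close>).

  For the second, passing to the next stage adjoins a single orbit, which is separable in the
  topology of pointwise convergence. Hence countably many of its members determine all the others on points, and by
  pseudocompactness they determine them continuously
  (\<open>pseudocompact_space_factor_through_metric\<close>). The next stage thus embeds in the product of the
  present one with the countable power of the real line, which is the metrizable kernel
  required (\<open>metrizable_kernel_adjoin_separable\<close>).
\<close>

section \<open>Pseudocompact spaces\<close>

lemma pseudocompact_space_continuous_map_image:
  assumes "pseudocompact_space X" "continuous_map X Y h" "h ` topspace X = topspace Y"
  shows "pseudocompact_space Y"
  unfolding pseudocompact_space_def
proof (intro allI impI)
  fix f assume "continuous_map Y euclideanreal f"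
  then have "continuous_map X euclideanreal (f \<circ> h)"
    using assms(2) continuous_map_compose by blast
  then have "bounded ((f \<circ> h) ` topspace X)"
    using assms(1) unfolding pseudocompact_space_def by blast
  then show "bounded (f ` topspace Y)"
    by (simp only: image_comp[symmetric] assms(3))
qed

text \<open>Otherwise the reciprocal would be an unbounded continuous function.\<close>

lemma pseudocompact_space_positive_lower_bound:
  assumes "pseudocompact_space X" "continuous_map X euclideanreal q"
    and pos: "\<And>x. x \<in> topspace X \<Longrightarrow> q x > 0"
  obtains \<delta> where "\<delta> > 0" "\<And>x. x \<in> topspace X \<Longrightarrow> \<delta> \<le> q x"
proof -
  have "continuous_map X euclideanreal (\<lambda>x. inverse (q x))"
    using assms(2) pos by (intro continuous_map_real_inverse) force+
  then have "bounded ((\<lambda>x. inverse (q x)) ` topspace X)"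
    using assms(1) unfolding pseudocompact_space_def by blast
  then obtain B where B: "B > 0" "\<And>x. x \<in> topspace X \<Longrightarrow> norm (inverse (q x)) \<le> B"
    unfolding bounded_pos by blast
  show thesis
  proof
    show "inverse B > 0"
      using B by simp
    show "inverse B \<le> q x" if "x \<in> topspace X" for x
      using B(2)[OF that] pos[OF that] B(1) by (simp add: field_simps)
  qed
qed

text \<open>Although \<open>m\<close> need not be a quotient map onto its image a priori, pseudocompactness supplies a
  modulus of continuity at each point, as a lower bound of a positive function. Consequently
  a set of functions whose values are determined by those of countably many of its members
  contributes no more to a topology than these members do.\<close>

lemma pseudocompact_space_factor_through_metric:
  fixes m :: "'a \<Rightarrow> 'b::metric_space"
  assumes X: "pseudocompact_space X" and m: "continuous_map X euclidean m"
    and f: "continuous_map X euclideanreal f"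
    and fibre: "\<And>x y. \<lbrakk>x \<in> topspace X; y \<in> topspace X; m x = m y\<rbrakk> \<Longrightarrow> f x = f y"
  obtains g where "continuous_on (m ` topspace X) g" "\<And>x. x \<in> topspace X \<Longrightarrow> g (m x) = f x"
proof -
  define g where "g = f \<circ> inv_into (topspace X) m"
  have gm: "g (m x) = f x" if "x \<in> topspace X" for x
    using fibre[of "inv_into (topspace X) m (m x)" x] that
    by (simp add: g_def f_inv_into_f inv_into_into)
  have "continuous_on (m ` topspace X) g"
    unfolding continuous_on_iff
  proof (intro ballI allI impI)
    fix w and \<epsilon> :: real assume "w \<in> m ` topspace X" "\<epsilon> > 0"
    then obtain x where x: "x \<in> topspace X" "w = m x" by blast
    \<comment> \<open>Where \<open>dist (m z) (m x)\<close> vanishes, the hypothesis on fibres makes the second summand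
      equal to \<open>\<epsilon>\<close>; where the second summand vanishes, \<open>f z\<close> is far from \<open>f x\<close>. A positive
      lower bound of the sum is therefore a modulus of continuity.\<close>
    define q where "q = (\<lambda>z. dist (m z) (m x) + max 0 (\<epsilon> - \<bar>f z - f x\<bar>))"
    have "continuous_map X euclideanreal ((\<lambda>w. dist w (m x)) \<circ> m)"
      by (rule continuous_map_compose[OF m]) (auto intro!: continuous_intros)
    then have "continuous_map X euclideanreal q"
      unfolding q_def comp_def using f by (intro continuous_intros) auto
    moreover have "q z > 0" if "z \<in> topspace X" for z
    proof (cases "m z = m x")
      case True
      then show ?thesis
        using fibre[OF that x(1)] \<open>\<epsilon> > 0\<close> by (simp add: q_def)
    next
      case False
      then show ?thesis
        by (simp add: q_def add_pos_nonneg)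
    qed
    ultimately obtain \<delta> where \<delta>: "\<delta> > 0" "\<And>z. z \<in> topspace X \<Longrightarrow> \<delta> \<le> q z"
      using pseudocompact_space_positive_lower_bound[OF X] by blast
    have "dist (g w') (g w) < \<epsilon>" if w': "w' \<in> m ` topspace X" "dist w' w < \<delta>" for w'
    proof -
      obtain z where z: "z \<in> topspace X" "w' = m z"
        using w' by blast
      have "dist (m z) (m x) < \<delta>" "\<delta> \<le> q z"
        using w' z x \<delta> by auto
      then have "\<bar>f z - f x\<bar> < \<epsilon>"
        by (simp add: q_def split: if_splits add: max_def)
      then show ?thesis
        by (simp add: z x gm dist_real_def)
    qed
    with \<delta>(1) show "\<exists>d>0. \<forall>x'\<in>m ` topspace X. dist x' w < d \<longrightarrow> dist (g x') (g w) < \<epsilon>"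
      by blast
  qed
  with gm that show thesis by blast
qed

lemma bump_function_avoiding_nowhere_dense:
  assumes "completely_regular_space X" "openin X W" "W \<noteq> {}" "closedin X N" "X interior_of N = {}"
  obtains f where "continuous_map X euclideanreal f" "\<And>x. f x \<ge> 0"
    "\<exists>x\<in>W. f x = 1" "\<And>x. \<lbrakk>x \<in> topspace X; x \<in> N \<or> x \<notin> W\<rbrakk> \<Longrightarrow> f x = 0"
proof -
  have "\<not> W \<subseteq> N"
    using assms interior_of_maximal by blast
  then obtain x where x: "x \<in> W - N" by blast
  have "openin X (W - N)"
    using assms by blast
  with x obtain f where f: "continuous_map X euclideanreal f" "f x = 1"
      "f ` (topspace X - (W - N)) \<subseteq> {0}"
    using assms(1) completely_regular_space_gen_alt'[of "1::real" 0 X] by (metis zero_neq_one)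
  show thesis
  proof
    show "continuous_map X euclideanreal (\<lambda>x. \<bar>f x\<bar>)"
      using f(1) by (rule continuous_map_real_abs)
    show "\<exists>x\<in>W. \<bar>f x\<bar> = 1"
      using f(2) x by force
    show "\<bar>f y\<bar> = 0" if "y \<in> topspace X" "y \<in> N \<or> y \<notin> W" for y
      using f(3) that by auto
  qed simp
qed

text \<open>If all \<open>N n\<close> had empty interior, one could choose bump functions \<open>f n\<close> that vanish on
  \<open>N n\<close>, attain the value 1, and live where the preceding function exceeds \<open>1/2\<close>. Since every point lies
  in some \<open>N n\<close>, the sum of all bumps is locally finite, hence continuous; but at a point where
  \<open>f n\<close> is 1 it is at least \<open>n / 2\<close>, contradicting pseudocompactness.\<close>

lemma pseudocompact_space_Baire:
  fixes N :: "nat \<Rightarrow> 'a set"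
  assumes X: "completely_regular_space X" "pseudocompact_space X" "topspace X \<noteq> {}"
    and N: "\<And>n. closedin X (N n)" and cover: "topspace X \<subseteq> (\<Union>n. N n)"
  obtains n where "X interior_of (N n) \<noteq> {}"
proof (rule ccontr)
  assume "\<not> thesis"
  with that have empty: "X interior_of (N n) = {}" for n by blast
  define P where "P = (\<lambda>n f. continuous_map X euclideanreal f \<and> (\<forall>x. f x \<ge> (0::real)) \<and>
     (\<exists>x\<in>topspace X. f x = 1) \<and> (\<forall>x\<in>topspace X \<inter> N n. f x = 0))"
  have "\<exists>f. \<forall>n. P n (f n) \<and> (\<forall>x\<in>topspace X. f n x \<le> 1/2 \<longrightarrow> f (Suc n) x = 0)"
  proof (rule dependent_nat_choice)
    obtain f where "continuous_map X euclideanreal f" "\<And>x. f x \<ge> 0"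
      "\<exists>x\<in>topspace X. f x = 1" "\<And>x. \<lbrakk>x \<in> topspace X; x \<in> N 0 \<or> x \<notin> topspace X\<rbrakk> \<Longrightarrow> f x = 0"
      using bump_function_avoiding_nowhere_dense[OF X(1) openin_topspace X(3) N empty] by metis
    then show "\<exists>f. P 0 f"
      unfolding P_def by blast
  next
    fix f n assume f: "P n f"
    define W where "W = {x \<in> topspace X. f x \<in> {1/2<..}}"
    have "openin X W"
      unfolding W_def using f by (intro openin_continuous_map_preimage) (auto simp: P_def)
    moreover have "W \<noteq> {}"
      using f unfolding P_def W_def by force
    ultimately obtain f' where f': "continuous_map X euclideanreal f'" "\<And>x. f' x \<ge> 0"
        "\<exists>x\<in>W. f' x = 1" "\<And>x. \<lbrakk>x \<in> topspace X; x \<in> N (Suc n) \<or> x \<notin> W\<rbrakk> \<Longrightarrow> f' x = 0"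
      using bump_function_avoiding_nowhere_dense[OF X(1) _ _ N empty] by metis
    then have "P (Suc n) f' \<and> (\<forall>x\<in>topspace X. f x \<le> 1/2 \<longrightarrow> f' x = 0)"
      unfolding P_def W_def by auto
    then show "\<exists>f'. P (Suc n) f' \<and> (\<forall>x\<in>topspace X. f x \<le> 1/2 \<longrightarrow> f' x = 0)"
      by (rule exI[of _ f'])
  qed
  then obtain f where f: "\<And>n. P n (f n)"
    and step: "\<And>n x. \<lbrakk>x \<in> topspace X; f n x \<le> 1/2\<rbrakk> \<Longrightarrow> f (Suc n) x = 0"
    by blast
  have cont: "continuous_map X euclideanreal (f n)" and nonneg: "f n x \<ge> 0" for n x
    using f unfolding P_def by auto
  have later: "f k x = 0" if "i < k" "x \<in> topspace X" "f i x \<le> 1/2" for i k x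
    using that
  proof (induction k)
    case (Suc k)
    then show ?case
      using step[of x k] by (cases "i = k") auto
  qed simp
  \<comment> \<open>On \<open>T n\<close> all bumps after the \<open>n\<close>-th vanish, so the infinite sum is a finite one there.\<close>
  define T where "T = (\<lambda>n. {x \<in> topspace X. f n x \<in> {..<1/2}})"
  have T: "f i x < 1/2" if "x \<in> T i" for i x
    using that by (simp add: T_def)
  have sums_agree: "(\<Sum>k\<le>i. f k x) = (\<Sum>k\<le>j. f k x)"
    if x: "x \<in> topspace X" "x \<in> T i" and ij: "i \<le> j" for i j x
  proof (rule sum.mono_neutral_left[OF finite_atMost])
    show "\<forall>k\<in>{..j} - {..i}. f k x = 0"
    proof
      fix k assume "k \<in> {..j} - {..i}"
      then have "i < k" by simp
      then show "f k x = 0"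
        using x(1) T[OF x(2)] by (rule later[OF _ _ less_imp_le])
    qed
  qed (use ij in auto)
  have T_cover: "topspace X \<subseteq> (\<Union>n\<in>UNIV. T n)"
  proof
    fix x assume x: "x \<in> topspace X"
    then obtain n where "x \<in> N n"
      using cover by blast
    then have "f n x = 0"
      using f[of n] x unfolding P_def by blast
    then show "x \<in> (\<Union>n\<in>UNIV. T n)"
      using x by (auto simp: T_def intro!: exI[of _ n])
  qed
  have T_open: "openin X (T n)" for n
    unfolding T_def using cont by (rule openin_continuous_map_preimage) simp
  have sums_cont: "continuous_map (subtopology X (T n)) euclideanreal (\<lambda>x. \<Sum>k\<le>n. f k x)" for n
    by (intro continuous_map_from_subtopology continuous_map_sum cont finite_atMost)
  have sums_compat: "(\<Sum>k\<le>i. f k x) = (\<Sum>k\<le>j. f k x)" if "x \<in> topspace X \<inter> T i \<inter> T j" for i j x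
    using sums_agree[of x i j] sums_agree[of x j i] that by (metis IntD1 IntD2 nle_le)
  obtain h where h: "continuous_map X euclideanreal h"
    "\<And>x n. \<lbrakk>n \<in> UNIV; x \<in> topspace X \<inter> T n\<rbrakk> \<Longrightarrow> h x = (\<Sum>k\<le>n. f k x)"
    using pasting_lemma_exists[where f = "\<lambda>n x. \<Sum>k\<le>n. f k x", OF T_cover T_open sums_cont sums_compat]
    by metis
  have "bounded (h ` topspace X)"
    using X(2) h(1) unfolding pseudocompact_space_def by blast
  then obtain B where B: "\<And>x. x \<in> topspace X \<Longrightarrow> \<bar>h x\<bar> \<le> B"
    unfolding bounded_iff by auto
  obtain n :: nat where n: "real n > 2 * B"
    using reals_Archimedean2 by blast
  obtain x where x: "x \<in> topspace X" "f n x = 1"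
    using f[of n] unfolding P_def by blast
  have large: "f k x \<ge> 1/2" if "k < n" for k
    using later[OF that x(1)] x(2) by force
  obtain m where m: "x \<in> T m"
    using T_cover x(1) by blast
  have "n < m"
    using later[of m n x] x T[OF m] by (cases m n rule: linorder_cases) auto
  have "real n / 2 = (\<Sum>k<n. 1/2)" by simp
  also have "\<dots> \<le> (\<Sum>k<n. f k x)"
    using large by (intro sum_mono) auto
  also have "\<dots> \<le> (\<Sum>k\<le>m. f k x)"
    using \<open>n < m\<close> nonneg by (intro sum_mono2) auto
  also have "\<dots> = h x"
    using h(2)[of m x] m x by simp
  finally show False
    using B[OF x(1)] n by linarith
qed

section \<open>Quotients by families of functions\<close>

text \<open>Identifying the points of \<open>X\<close> on which all functions of a family \<open>F\<close> agree yields the image of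
  \<open>X\<close> in \<open>\<real>\<close> to the power \<open>F\<close> under the diagonal map. A chosen representative of each class
  keeps this space on the type of \<open>X\<close>, so that all spaces of a tower have the same type and
  the projection onto every quotient, from \<open>X\<close> or from a finer quotient, is the same function
  \<open>rep X F\<close>.\<close>

definition rep :: "'a topology \<Rightarrow> ('a \<Rightarrow> real) set \<Rightarrow> 'a \<Rightarrow> 'a" where
  "rep X F x = (SOME y. y \<in> topspace X \<and> (\<forall>f\<in>F. f y = f x))"

definition func_quotient :: "'a topology \<Rightarrow> ('a \<Rightarrow> real) set \<Rightarrow> 'a topology" where
  "func_quotient X F = pullback_topology (rep X F ` topspace X) (\<lambda>x. \<lambda>f\<in>F. f x)
     (product_topology (\<lambda>_. euclideanreal) F)"

lemma
  assumes "x \<in> topspace X"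
  shows rep_in_topspace: "rep X F x \<in> topspace X"
    and rep_preserves: "f \<in> F \<Longrightarrow> f (rep X F x) = f x"
proof -
  have "rep X F x \<in> topspace X \<and> (\<forall>f\<in>F. f (rep X F x) = f x)"
    unfolding rep_def by (rule someI[of _ x]) (use assms in auto)
  then show "rep X F x \<in> topspace X" "f \<in> F \<Longrightarrow> f (rep X F x) = f x"
    by auto
qed

lemma rep_eqI:
  assumes "\<And>f. f \<in> F \<Longrightarrow> f x = f y"
  shows "rep X F x = rep X F y"
proof -
  have "(\<forall>f\<in>F. f z = f x) \<longleftrightarrow> (\<forall>f\<in>F. f z = f y)" for z
    using assms by (intro ball_cong refl) metis
  then show ?thesis
    unfolding rep_def by presburger
qed

lemma rep_rep: "\<lbrakk>F \<subseteq> F'; x \<in> topspace X\<rbrakk> \<Longrightarrow> rep X F (rep X F' x) = rep X F x"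
  by (rule rep_eqI) (simp add: rep_preserves subsetD)

lemma topspace_func_quotient: "topspace (func_quotient X F) = rep X F ` topspace X"
  by (auto simp: func_quotient_def topspace_pullback_topology)

lemma topspace_func_quotient_subset: "topspace (func_quotient X F) \<subseteq> topspace X"
  by (auto simp: topspace_func_quotient rep_in_topspace)

lemma rep_func_quotient: "y \<in> topspace (func_quotient X F) \<Longrightarrow> rep X F y = y"
  by (auto simp: topspace_func_quotient rep_rep)

lemma func_quotient_separated:
  assumes "y \<in> topspace (func_quotient X F)" "z \<in> topspace (func_quotient X F)"
    and "\<And>f. f \<in> F \<Longrightarrow> f y = f z"
  shows "y = z"
  using rep_eqI[of F y z X] assms rep_func_quotient by metis

lemma continuous_map_evaluation:
  "continuous_map (func_quotient X F) (product_topology (\<lambda>_. euclideanreal) F) (\<lambda>x. \<lambda>f\<in>F. f x)"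
  using continuous_map_pullback[OF continuous_map_id] unfolding func_quotient_def by fastforce

lemma continuous_map_from_func_quotient:
  "f \<in> F \<Longrightarrow> continuous_map (func_quotient X F) euclideanreal f"
  using continuous_map_evaluation[of X F] by (simp add: continuous_map_componentwise)

text \<open>The quotient carries the initial topology of \<open>F\<close>, so continuity of a map into it is
  tested on the functions in \<open>F\<close>.\<close>

lemma continuous_map_into_func_quotient:
  "continuous_map Z (func_quotient X F) h \<longleftrightarrow>
     h \<in> topspace Z \<rightarrow> topspace (func_quotient X F) \<and>
     (\<forall>f\<in>F. continuous_map Z euclideanreal (\<lambda>z. f (h z)))" (is "?lhs \<longleftrightarrow> ?rhs")
proof
  assume h: ?lhs
  then show ?rhs
    using continuous_map_compose[OF h continuous_map_from_func_quotient]
    by (auto simp: continuous_map_def comp_def)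
next
  assume h: ?rhs
  then have "continuous_map Z (product_topology (\<lambda>_. euclideanreal) F) ((\<lambda>x. \<lambda>f\<in>F. f x) \<circ> h)"
    by (auto simp: continuous_map_componentwise)
  moreover have "topspace Z \<subseteq> h -` (rep X F ` topspace X)"
    using h unfolding topspace_func_quotient Pi_iff by blast
  ultimately show ?lhs
    unfolding func_quotient_def by (rule continuous_map_pullback')
qed

lemma continuous_map_rep:
  assumes "\<And>f. f \<in> F \<Longrightarrow> continuous_map X euclideanreal f"
  shows "continuous_map X (func_quotient X F) (rep X F)"
proof -
  have "continuous_map X euclideanreal (\<lambda>x. f (rep X F x))" if "f \<in> F" for f
    using continuous_map_eq[OF assms[OF that]] rep_preserves[of _ X f F] that by metis
  then show ?thesis
    unfolding continuous_map_into_func_quotient topspace_func_quotient by blast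
qed

lemma continuous_map_rep_func_quotient:
  assumes "F \<subseteq> F'"
  shows "continuous_map (func_quotient X F') (func_quotient X F) (rep X F)"
proof -
  have "continuous_map (func_quotient X F') euclideanreal (\<lambda>x. f (rep X F x))" if "f \<in> F" for f
  proof (rule continuous_map_eq)
    show "continuous_map (func_quotient X F') euclideanreal f"
      using assms that by (intro continuous_map_from_func_quotient) auto
    show "f x = f (rep X F x)" if "x \<in> topspace (func_quotient X F')" for x
      using that \<open>f \<in> F\<close> rep_preserves topspace_func_quotient_subset by (metis subsetD)
  qed
  moreover have "rep X F \<in> topspace (func_quotient X F') \<rightarrow> topspace (func_quotient X F)"
    using topspace_func_quotient_subset[of X F'] by (auto simp: topspace_func_quotient)
  ultimately show ?thesis
    unfolding continuous_map_into_func_quotient by blast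
qed

text \<open>A continuous map that does not lose the values of any \<open>f \<in> F\<close> is injective because \<open>F\<close>
  separates the points of the quotient, and its inverse is continuous because continuity is
  tested on \<open>F\<close>. The embeddings required of the inverse system all have this form.\<close>

lemma embedding_map_from_func_quotient:
  assumes e: "continuous_map (func_quotient X F) Y e"
    and recover: "\<And>f. f \<in> F \<Longrightarrow>
      \<exists>g. continuous_map (subtopology Y (e ` topspace (func_quotient X F))) euclideanreal g \<and>
          (\<forall>x\<in>topspace (func_quotient X F). g (e x) = f x)"
  shows "embedding_map (func_quotient X F) Y e" (is "embedding_map ?Q Y e")
proof -
  let ?E = "subtopology Y (e ` topspace ?Q)"
  let ?k = "inv_into (topspace ?Q) e"
  have "inj_on e (topspace ?Q)"
  proof (rule inj_onI)
    fix x y assume xy: "x \<in> topspace ?Q" "y \<in> topspace ?Q" and eq: "e x = e y"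
    have "f x = f y" if "f \<in> F" for f
      using recover[OF that] xy eq by metis
    then show "x = y"
      using xy by (rule func_quotient_separated[rotated 2])
  qed
  then have k: "?k (e x) = x" if "x \<in> topspace ?Q" for x
    using that by (rule inv_into_f_f)
  have "continuous_map ?E euclideanreal (\<lambda>w. f (?k w))" if f: "f \<in> F" for f
  proof -
    obtain g where g: "continuous_map ?E euclideanreal g" "\<And>x. x \<in> topspace ?Q \<Longrightarrow> g (e x) = f x"
      using recover[OF f] by blast
    show ?thesis
    proof (rule continuous_map_eq[OF g(1)])
      fix w assume "w \<in> topspace ?E"
      then obtain x where x: "x \<in> topspace ?Q" "w = e x"
        by auto
      then show "g w = f (?k w)"
        using g(2) k by simp
    qed
  qed
  moreover have "?k \<in> topspace ?E \<rightarrow> topspace ?Q"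
    by (auto intro: inv_into_into)
  ultimately have "continuous_map ?E ?Q ?k"
    unfolding continuous_map_into_func_quotient by blast
  then have "homeomorphic_maps ?Q ?E e ?k"
    using e k by (auto simp: homeomorphic_maps_def continuous_map_in_subtopology)
  then show ?thesis
    unfolding embedding_map_def homeomorphic_map_maps by blast
qed

lemma embedding_map_evaluation:
  "embedding_map (func_quotient X F) (product_topology (\<lambda>_. euclideanreal) F) (\<lambda>x. \<lambda>f\<in>F. f x)"
proof (rule embedding_map_from_func_quotient[OF continuous_map_evaluation])
  fix f assume f: "f \<in> F"
  have "continuous_map (subtopology (product_topology (\<lambda>_. euclideanreal) F) A) euclideanreal (\<lambda>v. v f)" for A
    using f by (intro continuous_map_from_subtopology continuous_map_product_projection)
  with f show "\<exists>g. continuous_map (subtopology (product_topology (\<lambda>_. euclideanreal) F)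
      ((\<lambda>x. \<lambda>f\<in>F. f x) ` topspace (func_quotient X F))) euclideanreal g \<and>
      (\<forall>x\<in>topspace (func_quotient X F). g (\<lambda>f\<in>F. f x) = f x)"
    by (intro exI[of _ "\<lambda>v. v f"]) simp
qed

lemma Tychonoff_space_func_quotient: "Tychonoff_space (func_quotient X F)"
proof -
  let ?P = "product_topology (\<lambda>_. euclideanreal) F"
  have "completely_regular_space ?P" "Hausdorff_space ?P"
    by (simp_all add: completely_regular_space_product_topology Hausdorff_space_product_topology
        metrizable_imp_completely_regular_space metrizable_space_euclidean)
  then show ?thesis
    using embedding_map_imp_homeomorphic_space[OF embedding_map_evaluation[of X F]]
    unfolding Tychonoff_space_def
    by (metis homeomorphic_completely_regular_space homeomorphic_Hausdorff_space
        completely_regular_space_subtopology Hausdorff_space_subtopology)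
qed

lemma metrizable_space_func_quotient:
  assumes "countable F"
  shows "metrizable_space (func_quotient X F)"
proof -
  have "countable {i \<in> F. \<not> (\<exists>a. topspace euclideanreal \<subseteq> {a})}"
    using assms by (rule countable_subset[rotated]) auto
  then have "metrizable_space (product_topology (\<lambda>_. euclideanreal) F)"
    unfolding metrizable_space_product_topology by (simp add: metrizable_space_euclidean)
  then show ?thesis
    using embedding_map_imp_homeomorphic_space[OF embedding_map_evaluation[of X F]]
    by (metis homeomorphic_metrizable_space metrizable_space_subtopology)
qed

lemma in_topspace_Cp:
  "f \<in> topspace (Cp X) \<longleftrightarrow> f \<in> extensional (topspace X) \<and> continuous_map X euclideanreal f"
  by (auto simp: Cp_def PiE_def)

lemma restrict_in_topspace_Cp:
  "continuous_map X euclideanreal f \<Longrightarrow> restrict f (topspace X) \<in> topspace (Cp X)"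
  by (auto simp: in_topspace_Cp intro: continuous_map_eq)

lemma Tychonoff_space_Cp_separates:
  assumes "Tychonoff_space X" "openin X U" "x \<in> U"
  obtains f where "f \<in> topspace (Cp X)" "f x = 1" "\<And>y. y \<in> topspace X - U \<Longrightarrow> f y = 0"
proof -
  obtain f where f: "continuous_map X euclideanreal f" "f x = 1" "f ` (topspace X - U) \<subseteq> {0}"
    using assms completely_regular_space_gen_alt'[of "1::real" 0 X]
    unfolding Tychonoff_space_def by (metis zero_neq_one)
  show thesis
  proof
    show "restrict f (topspace X) \<in> topspace (Cp X)"
      using f(1) by (rule restrict_in_topspace_Cp)
    show "restrict f (topspace X) x = 1"
      using f(2) assms(2,3) openin_subset by fastforce
    show "restrict f (topspace X) y = 0" if "y \<in> topspace X - U" for y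
      using f(3) that by auto
  qed
qed

lemma rep_Cp:
  assumes X: "Tychonoff_space X" and x: "x \<in> topspace X"
  shows "rep X (topspace (Cp X)) x = x"
proof (rule ccontr)
  let ?y = "rep X (topspace (Cp X)) x"
  assume "?y \<noteq> x"
  then obtain U V where "openin X U" "x \<in> U" "?y \<notin> U"
    using X x rep_in_topspace[OF x] unfolding Tychonoff_space_def Hausdorff_space_def
    by (metis disjnt_iff)
  then obtain f where f: "f \<in> topspace (Cp X)" "f x = 1" "\<And>z. z \<in> topspace X - U \<Longrightarrow> f z = 0"
    using Tychonoff_space_Cp_separates[OF X] by metis
  have "f ?y = 0"
    using f(3) rep_in_topspace[OF x] \<open>?y \<notin> U\<close> by blast
  with rep_preserves[OF x f(1)] f(2) show False by simp
qed

text \<open>Complete regularity means that \<open>X\<close> itself is the quotient for the family of all continuous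
  functions; it will be the top of the tower.\<close>

lemma func_quotient_Cp:
  assumes X: "Tychonoff_space X"
  shows "func_quotient X (topspace (Cp X)) = X"
proof (rule topology_eq[THEN iffD2], intro allI iffI)
  let ?Q = "func_quotient X (topspace (Cp X))"
  have rep: "rep X (topspace (Cp X)) x = x" if "x \<in> topspace X" for x
    using rep_Cp[OF X that] .
  then have top: "topspace ?Q = topspace X"
    by (force simp: topspace_func_quotient)
  fix U
  {
    assume U: "openin ?Q U"
    have "continuous_map X ?Q (rep X (topspace (Cp X)))"
      by (intro continuous_map_rep) (auto simp: in_topspace_Cp)
    then have "openin X {x \<in> topspace X. rep X (topspace (Cp X)) x \<in> U}"
      using U by (rule openin_continuous_map_preimage)
    also have "{x \<in> topspace X. rep X (topspace (Cp X)) x \<in> U} = U"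
      using rep openin_subset[OF U] top by auto
    finally show "openin X U" .
  }
  {
    assume U: "openin X U"
    have "\<exists>W. openin ?Q W \<and> x \<in> W \<and> W \<subseteq> U" if x: "x \<in> U" for x
    proof -
      obtain f where f: "f \<in> topspace (Cp X)" "f x = 1" "\<And>y. y \<in> topspace X - U \<Longrightarrow> f y = 0"
        using Tychonoff_space_Cp_separates[OF X U x] by metis
      have "openin ?Q {y \<in> topspace ?Q. f y \<in> {0<..}}"
        using continuous_map_from_func_quotient[OF f(1)]
        by (rule openin_continuous_map_preimage) auto
      moreover have "x \<in> {y \<in> topspace ?Q. f y \<in> {0<..}}"
        using f(2) x U openin_subset top by fastforce
      moreover have "{y \<in> topspace ?Q. f y \<in> {0<..}} \<subseteq> U"
        using f(3) by (force simp: top)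
      ultimately show ?thesis by blast
    qed
    then show "openin ?Q U"
      by (subst openin_subopen) blast
  }
qed

section \<open>Towers of families of functions\<close>

text \<open>As \<open>q\<close> is surjective, the image under \<open>p\<close> of an open set equals the image under
  \<open>p \<circ> q\<close> of its preimage. Thus only the projections from \<open>X\<close> need
  to be examined.\<close>

lemma skeletal_map_outer_factor:
  assumes qp: "skeletal_map X Z (\<lambda>x. p (q x))"
    and q: "continuous_map X Y q" "q ` topspace X = topspace Y" and p: "continuous_map Y Z p"
  shows "skeletal_map Y Z p"
  unfolding skeletal_map_def
proof (intro conjI allI impI)
  fix U assume U: "openin Y U \<and> U \<noteq> {}"
  define V where "V = {x \<in> topspace X. q x \<in> U}"
  have "openin X V"
    unfolding V_def using q(1) U by (intro openin_continuous_map_preimage) auto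
  have "U \<subseteq> q ` topspace X"
    using openin_subset U q(2) by metis
  then have "q ` V = U"
    unfolding V_def by blast
  then have "V \<noteq> {}" and "(\<lambda>x. p (q x)) ` V = p ` U"
    using U by (auto simp flip: image_image)
  then show "Z interior_of (Z closure_of (p ` U)) \<noteq> {}"
    using qp \<open>openin X V\<close> unfolding skeletal_map_def by metis
qed (rule p)

lemma underS_trans:
  assumes r: "Well_order r" and "\<gamma> \<in> underS r \<alpha>" "\<alpha> \<in> underS r \<beta>"
  shows "\<gamma> \<in> underS r \<beta>"
proof -
  have "trans r" "antisym r"
    using r by (simp_all add: order_on_defs)
  then show ?thesis
    using assms(2,3) unfolding underS_def by (blast dest: transD antisymD)
qed

lemma underS_if_not_le:
  assumes r: "Well_order r" and Field: "\<alpha> \<in> Field r" "\<beta> \<in> Field r" and "(\<alpha>, \<beta>) \<notin> r"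
  shows "\<beta> \<in> underS r \<alpha>"
proof -
  have total: "total_on (Field r) r" and refl: "refl_on (Field r) r"
    using r by (simp_all add: order_on_defs)
  have "\<alpha> \<noteq> \<beta>"
    using refl_onD[OF refl Field(1)] assms(4) by metis
  then have "(\<beta>, \<alpha>) \<in> r"
    using total assms(4) Field unfolding total_on_def by metis
  with \<open>\<alpha> \<noteq> \<beta>\<close> show ?thesis
    by (simp add: underS_def)
qed

text \<open>The families increase so that each quotient projects onto the earlier ones, by a map \<open>rep\<close> that
  depends on the target only.\<close>

locale function_tower =
  fixes X :: "'a topology" and r :: "'i rel" and F :: "'i \<Rightarrow> ('a \<Rightarrow> real) set"
  assumes wo: "Well_order r"
    and F_continuous: "\<lbrakk>\<alpha> \<in> Field r; f \<in> F \<alpha>\<rbrakk> \<Longrightarrow> continuous_map X euclideanreal f"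
    and F_mono: "\<lbrakk>\<beta> \<in> Field r; \<alpha> \<in> underS r \<beta>\<rbrakk> \<Longrightarrow> F \<alpha> \<subseteq> F \<beta>"
begin

abbreviation S :: "'i \<Rightarrow> 'a topology" where
  "S \<alpha> \<equiv> func_quotient X (F \<alpha>)"

abbreviation bond :: "'i \<Rightarrow> 'i \<Rightarrow> 'a \<Rightarrow> 'a" where
  "bond \<alpha> \<beta> \<equiv> rep X (F \<alpha>)"

abbreviation coords :: "'i set \<Rightarrow> 'a \<Rightarrow> 'i \<Rightarrow> 'a" where
  "coords I x \<equiv> (\<lambda>\<alpha>\<in>I. rep X (F \<alpha>) x)"

lemma underS_Field: "\<alpha> \<in> underS r \<beta> \<Longrightarrow> \<alpha> \<in> Field r"
  by (auto simp: underS_def Field_def)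

lemma inverse_system_S: "inverse_system r S bond"
  unfolding inverse_system_def
proof (intro conjI ballI)
  show "Tychonoff_space (S \<alpha>)" for \<alpha>
    by (rule Tychonoff_space_func_quotient)
  show "continuous_map (S \<beta>) (S \<alpha>) (rep X (F \<alpha>))" if "\<beta> \<in> Field r" "\<alpha> \<in> underS r \<beta>" for \<alpha> \<beta>
    using F_mono[OF that] by (rule continuous_map_rep_func_quotient)
  show "rep X (F \<alpha>) x = rep X (F \<alpha>) (rep X (F \<beta>) x)"
    if "\<beta> \<in> underS r \<gamma>" "\<alpha> \<in> underS r \<beta>" "x \<in> topspace (S \<gamma>)" for \<alpha> \<beta> \<gamma> x
    using rep_rep[OF F_mono[OF underS_Field[OF that(1)] that(2)]] that(3)
      topspace_func_quotient_subset[of X "F \<gamma>"] by (simp add: subset_iff)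
qed

lemma bond_surj:
  assumes "F \<alpha> \<subseteq> \<Phi>"
  shows "rep X (F \<alpha>) ` topspace (func_quotient X \<Phi>) = topspace (S \<alpha>)"
  using rep_rep[OF assms] by (auto simp: topspace_func_quotient image_image)

lemma skeletal_bond:
  assumes "skeletal_map X (S \<alpha>) (rep X (F \<alpha>))" "\<beta> \<in> Field r" "\<alpha> \<in> underS r \<beta>"
  shows "skeletal_map (S \<beta>) (S \<alpha>) (bond \<alpha> \<beta>)"
proof (rule skeletal_map_outer_factor)
  have sub: "F \<alpha> \<subseteq> F \<beta>"
    using assms(2,3) by (rule F_mono)
  show "continuous_map X (S \<beta>) (rep X (F \<beta>))"
    using F_continuous[OF assms(2)] by (rule continuous_map_rep)
  show "continuous_map (S \<beta>) (S \<alpha>) (rep X (F \<alpha>))"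
    using sub by (rule continuous_map_rep_func_quotient)
  show "rep X (F \<beta>) ` topspace X = topspace (S \<beta>)"
    by (simp add: topspace_func_quotient)
  have "continuous_map X (S \<alpha>) (\<lambda>x. rep X (F \<alpha>) (rep X (F \<beta>) x))"
    using continuous_map_compose[OF \<open>continuous_map X (S \<beta>) _\<close> \<open>continuous_map (S \<beta>) (S \<alpha>) _\<close>]
    by (simp add: comp_def)
  moreover have "(\<lambda>x. rep X (F \<alpha>) (rep X (F \<beta>) x)) ` U = rep X (F \<alpha>) ` U" if "openin X U" for U
    using rep_rep[OF sub] openin_subset[OF that] by (intro image_cong) auto
  ultimately show "skeletal_map X (S \<alpha>) (\<lambda>x. rep X (F \<alpha>) (rep X (F \<beta>) x))"
    using assms(1) unfolding skeletal_map_def by simp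
qed

lemma coords_in_limit:
  assumes "I \<subseteq> Field r" "x \<in> topspace X"
  shows "coords I x \<in> topspace (inverse_limit r I S bond)"
proof -
  have "rep X (F \<alpha>) (rep X (F \<beta>) x) = rep X (F \<alpha>) x" if "\<beta> \<in> I" "\<alpha> \<in> underS r \<beta>" for \<alpha> \<beta>
    using that assms F_mono by (intro rep_rep) blast+
  then show ?thesis
    using assms(2) by (auto simp: inverse_limit_def topspace_func_quotient)
qed

lemma continuous_map_limit_projection:
  "\<alpha> \<in> I \<Longrightarrow> continuous_map (inverse_limit r I S bond) (S \<alpha>) (\<lambda>w. w \<alpha>)"
  unfolding inverse_limit_def
  by (intro continuous_map_from_subtopology continuous_map_product_projection)

text \<open>Each function that generates the topology of the quotient can be read off from one
  coordinate in the limit.\<close>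

lemma embedding_map_coords:
  assumes I: "I \<subseteq> Field r" and \<Phi>: "\<Phi> = (\<Union>\<alpha>\<in>I. F \<alpha>)"
  shows "embedding_map (func_quotient X \<Phi>) (inverse_limit r I S bond) (coords I)"
    (is "embedding_map ?Q ?L _")
proof (rule embedding_map_from_func_quotient)
  have sub: "F \<alpha> \<subseteq> \<Phi>" if "\<alpha> \<in> I" for \<alpha>
    using that \<Phi> by blast
  have "continuous_map ?Q (product_topology S I) (coords I)"
    unfolding continuous_map_componentwise
  proof (intro conjI ballI)
    show "coords I ` topspace ?Q \<subseteq> extensional I"
      by (simp add: image_subset_iff)
    show "continuous_map ?Q (S \<alpha>) (\<lambda>x. coords I x \<alpha>)" if "\<alpha> \<in> I" for \<alpha>
      using continuous_map_rep_func_quotient[OF sub[OF that]] that by simp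
  qed
  moreover have "coords I ` topspace ?Q \<subseteq> topspace ?L"
    using coords_in_limit[OF I] topspace_func_quotient_subset[of X \<Phi>] by blast
  ultimately show "continuous_map ?Q ?L (coords I)"
    unfolding inverse_limit_def by (auto simp: continuous_map_in_subtopology)
  fix f assume "f \<in> \<Phi>"
  then obtain \<alpha> where \<alpha>: "\<alpha> \<in> I" "f \<in> F \<alpha>"
    using \<Phi> by blast
  have "continuous_map (subtopology ?L (coords I ` topspace ?Q)) euclideanreal (\<lambda>w. f (w \<alpha>))"
    using continuous_map_compose[OF continuous_map_limit_projection[OF \<alpha>(1)]
        continuous_map_from_func_quotient[OF \<alpha>(2)]]
    by (simp add: comp_def continuous_map_from_subtopology)
  moreover have "f (coords I x \<alpha>) = f x" if "x \<in> topspace ?Q" for x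
    using rep_preserves[OF _ \<alpha>(2)] \<alpha>(1) that topspace_func_quotient_subset[of X \<Phi>] by auto
  ultimately show "\<exists>g. continuous_map (subtopology ?L (coords I ` topspace ?Q)) euclideanreal g \<and>
      (\<forall>x\<in>topspace ?Q. g (coords I x) = f x)"
    by (intro exI[of _ "\<lambda>w. f (w \<alpha>)"]) blast
qed

lemma finite_upper_bound:
  assumes "finite K" "K \<subseteq> I" "I \<subseteq> Field r" "I \<noteq> {}"
  obtains m where "m \<in> I" "\<And>k. k \<in> K \<Longrightarrow> k = m \<or> k \<in> underS r m"
proof -
  have "\<exists>m\<in>I. \<forall>k\<in>K. k = m \<or> k \<in> underS r m"
    using assms(1,2)
  proof (induction K rule: finite_induct)
    case empty
    then show ?case
      using assms(4) by blast
  next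
    case (insert j K)
    then obtain m where m: "m \<in> I" "\<And>k. k \<in> K \<Longrightarrow> k = m \<or> k \<in> underS r m"
      by blast
    have "j \<in> Field r" "m \<in> Field r"
      using insert.prems m(1) assms(3) by auto
    then have total: "j = m \<or> j \<in> underS r m \<or> m \<in> underS r j"
      using underS_if_not_le[OF wo, of m j] by (auto simp: underS_def)
    from total show ?case
    proof (elim disjE)
      assume "m \<in> underS r j"
      then show ?case
        using m underS_trans[OF wo] insert.prems by (intro bexI[of _ j]) blast+
    qed (use m in blast)+
  qed
  with that show thesis by blast
qed

text \<open>A basic open set of the limit restricts finitely many coordinates, and all of them are
  determined by the coordinate at the largest index involved. The projection onto that
  coordinate is surjective.\<close>

lemma coords_dense:
  assumes I: "I \<subseteq> Field r" "I \<noteq> {}" and sub: "\<And>\<alpha>. \<alpha> \<in> I \<Longrightarrow> F \<alpha> \<subseteq> \<Phi>"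
  shows "(inverse_limit r I S bond) closure_of (coords I ` topspace (func_quotient X \<Phi>)) =
    topspace (inverse_limit r I S bond)" (is "?L closure_of ?E = _")
proof (rule subset_antisym[OF closure_of_subset_topspace] subsetI)+
  fix w assume w: "w \<in> topspace ?L"
  have compat: "rep X (F \<alpha>) (w \<beta>) = w \<alpha>" if "\<beta> \<in> I" "\<alpha> \<in> I" "\<alpha> \<in> underS r \<beta>" for \<alpha> \<beta>
    using w that by (simp add: inverse_limit_def)
  have "\<exists>y. y \<in> ?E \<and> y \<in> N" if N: "w \<in> N" "openin ?L N" for N
  proof -
    obtain N' where N': "openin (product_topology S I) N'"
      "N = N' \<inter> {x. \<forall>\<beta>\<in>I. \<forall>\<alpha>\<in>I \<inter> underS r \<beta>. rep X (F \<alpha>) (x \<beta>) = x \<alpha>}"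
      using N(2) unfolding inverse_limit_def openin_subtopology by blast
    then obtain U where U: "finite {i \<in> I. U i \<noteq> topspace (S i)}" "w \<in> Pi\<^sub>E I U" "Pi\<^sub>E I U \<subseteq> N'"
      using bspec[OF N'(1)[unfolded openin_product_topology_alt], of w] N(1) by blast
    obtain m where m: "m \<in> I" "\<And>k. k \<in> {i \<in> I. U i \<noteq> topspace (S i)} \<Longrightarrow> k = m \<or> k \<in> underS r m"
      using finite_upper_bound[OF U(1) _ I] by blast
    have "w m \<in> topspace (S m)"
      using continuous_map_image_subset_topspace[OF continuous_map_limit_projection[OF m(1)]] w by blast
    then obtain x where x: "x \<in> topspace (func_quotient X \<Phi>)" "w m = rep X (F m) x"
      using bond_surj[OF sub[OF m(1)]] by blast
    then have xX: "x \<in> topspace X"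
      using subsetD[OF topspace_func_quotient_subset x(1)] by blast
    have "rep X (F i) x \<in> U i" if i: "i \<in> I" for i
    proof (cases "U i = topspace (S i)")
      case True
      then show ?thesis
        using xX by (simp add: topspace_func_quotient)
    next
      case False
      then consider "i = m" | "i \<in> underS r m"
        using m(2)[of i] i by blast
      then have "rep X (F i) x = w i"
      proof cases
        case 2
        then have "rep X (F i) (rep X (F m) x) = rep X (F i) x"
          using m(1) I(1) F_mono xX by (intro rep_rep) blast+
        then show ?thesis
          using compat[OF m(1) i 2] x(2) by simp
      qed (simp add: x(2))
      then show ?thesis
        using U(2) i by auto
    qed
    then have "coords I x \<in> N'"
      using U(3) by (auto simp: subset_iff PiE_iff)
    moreover have "coords I x \<in> topspace ?L"
      using I(1) xX by (rule coords_in_limit)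
    ultimately have "coords I x \<in> N"
      unfolding N'(2) by (simp add: inverse_limit_def)
    then show ?thesis
      using x(1) by blast
  qed
  then show "w \<in> ?L closure_of ?E"
    using w by (simp add: in_closure_of)
qed

text \<open>That continuous functions on the limit factor through one stage is a matter of density: the
  restriction of such a function to the dense copy of \<open>X\<close> is one of the functions in some
  \<open>F \<alpha>\<close>, hence factors through the \<open>\<alpha>\<close>-th coordinate on \<open>X\<close> and therefore on the whole limit. This is
  why the tower has to exhaust all continuous functions rather than a generating set.\<close>

lemma skeletally_Dugundji_system_S:
  assumes X: "Tychonoff_space X" and r: "Card_order r" "Field r \<noteq> {}"
    and zero: "\<And>\<alpha>. \<lbrakk>\<alpha> \<in> Field r; underS r \<alpha> = {}\<rbrakk> \<Longrightarrow> F \<alpha> = {}"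
    and succ: "\<And>\<alpha> \<beta>. is_successor r \<alpha> \<beta> \<Longrightarrow> metrizable_kernel (S \<beta>) (S \<alpha>) (bond \<alpha> \<beta>)"
    and lim: "\<And>\<gamma>. is_limit r \<gamma> \<Longrightarrow> F \<gamma> \<subseteq> (\<Union>\<alpha>\<in>underS r \<gamma>. F \<alpha>)"
    and exhaust: "topspace (Cp X) = (\<Union>\<alpha>\<in>Field r. F \<alpha>)"
    and skeletal: "\<And>\<alpha>. \<alpha> \<in> Field r \<Longrightarrow> skeletal_map X (S \<alpha>) (rep X (F \<alpha>))"
  shows "skeletally_Dugundji_system X r S bond"
  unfolding skeletally_Dugundji_system_def Let_def
proof (intro conjI ballI allI impI)
  show "Card_order r" "Field r \<noteq> {}"
    by (fact r)+
  show "inverse_system r S bond"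
    by (rule inverse_system_S)
  fix \<alpha> \<beta> assume "\<beta> \<in> Field r" "\<alpha> \<in> underS r \<beta>"
  then show "rep X (F \<alpha>) ` topspace (S \<beta>) = topspace (S \<alpha>)"
    and "skeletal_map (S \<beta>) (S \<alpha>) (rep X (F \<alpha>))"
    using F_mono bond_surj skeletal_bond skeletal underS_Field by metis+
next
  fix \<alpha> assume "\<alpha> \<in> Field r" "underS r \<alpha> = {}"
  then have "F \<alpha> = {}"
    by (rule zero)
  then show "metrizable_space (S \<alpha>)"
    by (simp add: metrizable_space_func_quotient)
  have "topspace (S \<alpha>) \<subseteq> {rep X {} undefined}"
    using \<open>F \<alpha> = {}\<close> by (auto simp: topspace_func_quotient intro: rep_eqI)
  then have "countable (topspace (S \<alpha>))"
    using countable_subset by blast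
  then show "separable_space (S \<alpha>)"
    unfolding separable_space_def by (metis closure_of_topspace subset_refl)
next
  fix \<alpha> \<beta> assume "is_successor r \<alpha> \<beta>"
  then show "metrizable_kernel (S \<beta>) (S \<alpha>) (rep X (F \<alpha>))"
    by (rule succ)
next
  fix \<gamma> assume \<gamma>: "is_limit r \<gamma>"
  then have Field: "\<gamma> \<in> Field r" and ne: "underS r \<gamma> \<noteq> {}"
    by (simp_all add: is_limit_def)
  have I: "underS r \<gamma> \<subseteq> Field r"
    using underS_Field by blast
  have F: "F \<gamma> = (\<Union>\<alpha>\<in>underS r \<gamma>. F \<alpha>)"
    using lim[OF \<gamma>] F_mono[OF Field] by blast
  show "embedding_map (S \<gamma>) (inverse_limit r (underS r \<gamma>) S bond) (coords (underS r \<gamma>))"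
    using I F by (rule embedding_map_coords)
  show "(inverse_limit r (underS r \<gamma>) S bond) closure_of (coords (underS r \<gamma>) ` topspace (S \<gamma>)) =
      topspace (inverse_limit r (underS r \<gamma>) S bond)"
    using I ne F_mono[OF Field] by (rule coords_dense)
next
  have "embedding_map X (inverse_limit r (Field r) S bond) (coords (Field r))"
    using embedding_map_coords[OF subset_refl exhaust] func_quotient_Cp[OF X] by simp
  moreover have "(\<lambda>x. coords (Field r) x \<alpha>) ` topspace X = topspace (S \<alpha>)" if "\<alpha> \<in> Field r" for \<alpha>
    using that by (simp add: topspace_func_quotient)
  ultimately show "\<exists>e. embedding_map X (inverse_limit r (Field r) S bond) e \<and>
      (\<forall>\<alpha>\<in>Field r. (\<lambda>x. e x \<alpha>) ` topspace X = topspace (S \<alpha>))"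
    by blast
next
  let ?L = "inverse_limit r (Field r) S bond"
  fix f assume f: "continuous_map ?L euclideanreal f \<and> bounded (f ` topspace ?L)"
  have "continuous_map X ?L (coords (Field r))"
    using embedding_map_coords[OF subset_refl exhaust] func_quotient_Cp[OF X]
    by (simp add: embedding_map_def homeomorphic_imp_continuous_map
        continuous_map_into_fulltopology[OF homeomorphic_imp_continuous_map])
  then have "continuous_map X euclideanreal (\<lambda>x. f (coords (Field r) x))"
    using f continuous_map_compose by (fastforce simp: comp_def)
  then have "(\<lambda>x\<in>topspace X. f (coords (Field r) x)) \<in> topspace (Cp X)" (is "?g \<in> _")
    by (rule restrict_in_topspace_Cp)
  then obtain \<alpha> where \<alpha>: "\<alpha> \<in> Field r" "?g \<in> F \<alpha>"
    using exhaust by blast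
  have g: "continuous_map (S \<alpha>) euclideanreal ?g"
    using \<alpha>(2) by (rule continuous_map_from_func_quotient)
  have "f w = ?g (w \<alpha>)" if "w \<in> topspace ?L" for w
  proof (rule forall_in_closure_of_eq[where f = f and X = ?L and Y = euclideanreal])
    have "?L closure_of (coords (Field r) ` topspace (func_quotient X (topspace (Cp X)))) = topspace ?L"
      using r(2) exhaust by (intro coords_dense) auto
    then show "w \<in> ?L closure_of (coords (Field r) ` topspace X)"
      using that by (simp add: func_quotient_Cp[OF X])
    show "continuous_map ?L euclideanreal (\<lambda>w. ?g (w \<alpha>))"
      using continuous_map_compose[OF continuous_map_limit_projection[OF \<alpha>(1)] g] by (simp only: comp_def)
    fix v assume "v \<in> coords (Field r) ` topspace X"
    then obtain x where x: "x \<in> topspace X" "v = coords (Field r) x" by blast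
    then show "f v = ?g (v \<alpha>)"
      using rep_preserves[OF x(1) \<alpha>(2)] \<alpha>(1) by simp
  qed (use f in auto)
  with \<alpha>(1) g show "\<exists>\<alpha>\<in>Field r. \<exists>g. continuous_map (S \<alpha>) euclideanreal g \<and>
      (\<forall>x\<in>topspace ?L. f x = g (x \<alpha>))"
    by blast
qed

end

section \<open>Transitive actions of \<open>\<omega>\<close>-narrow groups\<close>

locale narrow_transitive_action = transitive_action G "topspace X" \<theta>
  for G :: "('g, 'm) monoid_scheme" (structure) and X :: "'a topology" and \<theta> +
  fixes T :: "'g topology"
  assumes topspace_T: "topspace T = carrier G"
    and narrow: "omega_narrow G T"
    and continuous_act: "g \<in> carrier G \<Longrightarrow> continuous_map X X (\<theta> g)"
    and continuous_orbit: "x \<in> topspace X \<Longrightarrow> continuous_map T X (\<lambda>g. \<theta> g x)"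
    and pseudocompact: "pseudocompact_space X"
begin

sublocale group G
  using group_hom by (simp add: group_hom_def)

lemma act_closed: "\<lbrakk>g \<in> carrier G; x \<in> topspace X\<rbrakk> \<Longrightarrow> \<theta> g x \<in> topspace X"
  using continuous_act by (auto simp: continuous_map_def)

lemma act_one: "x \<in> topspace X \<Longrightarrow> \<theta> \<one> x = x"
  by (metis id_eq_one restrict_apply')

lemma right_action_in_Cp:
  assumes "g \<in> carrier G" "f \<in> topspace (Cp X)"
  shows "right_action X \<theta> g f \<in> topspace (Cp X)"
proof -
  have "continuous_map X euclideanreal (f \<circ> \<theta> g)"
    using assms continuous_act by (auto simp: in_topspace_Cp intro: continuous_map_compose)
  then show ?thesis
    using restrict_in_topspace_Cp unfolding right_action_def comp_def by blast
qed

lemma right_action_right_action: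
  assumes "g \<in> carrier G" "h \<in> carrier G"
  shows "right_action X \<theta> g (right_action X \<theta> h f) = right_action X \<theta> (h \<otimes> g) f"
  using assms act_closed composition_rule by (auto simp: right_action_def fun_eq_iff)

lemma right_action_one:
  assumes "f \<in> topspace (Cp X)"
  shows "right_action X \<theta> \<one> f = f"
proof
  fix x
  have "f x = undefined" if "x \<notin> topspace X"
    using assms that in_topspace_Cp extensional_arb by metis
  then show "right_action X \<theta> \<one> f x = f x"
    by (cases "x \<in> topspace X") (simp_all add: right_action_def act_one)
qed

text \<open>For \<open>u \<in> U\<close> the set of all \<open>g\<close> with \<open>\<theta> g u \<in> U\<close> is a neighbourhood of the neutral element.
  Countably many translates of it exhaust \<open>G\<close>, and the orbit of \<open>u\<close> is all of \<open>X\<close>.\<close>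

lemma countable_translates_cover:
  assumes "openin X U" "U \<noteq> {}"
  obtains A where "A \<subseteq> carrier G" "countable A" "topspace X \<subseteq> (\<Union>a\<in>A. \<theta> a ` U)"
proof -
  obtain u where u: "u \<in> U" "u \<in> topspace X"
    using assms openin_subset by blast
  define V where "V = {g \<in> topspace T. \<theta> g u \<in> U}"
  have "openin T V"
    unfolding V_def using continuous_orbit[OF u(2)] assms(1) by (rule openin_continuous_map_preimage)
  moreover have "\<one> \<in> V" and V: "V \<subseteq> carrier G"
    using u act_one by (auto simp: V_def topspace_T)
  ultimately obtain A where A: "A \<subseteq> carrier G" "countable A" "A <#> V = carrier G"
    using narrow[unfolded omega_narrow_def, rule_format, OF V] by blast
  have "x \<in> (\<Union>a\<in>A. \<theta> a ` U)" if x: "x \<in> topspace X" for x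
  proof -
    obtain g where g: "g \<in> carrier G" "\<theta> g u = x"
      using unique_orbit[OF u(2) x] by blast
    then obtain a v where av: "a \<in> A" "v \<in> V" "g = a \<otimes> v"
      using A(3) unfolding set_mult_def by blast
    then have "x = \<theta> a (\<theta> v u)"
      using composition_rule[OF u(2), of a v] A(1) \<open>V \<subseteq> carrier G\<close> g(2) by blast
    moreover have "\<theta> v u \<in> U"
      using av(2) by (simp add: V_def)
    ultimately show ?thesis
      using av(1) by blast
  qed
  with A that show thesis by blast
qed

text \<open>If \<open>F\<close> is invariant, the action descends to an action on the quotient by homeomorphisms \<open>\<psi> g\<close>.
  The translates of the closure of the image of an open set by countably many of them cover the
  quotient, which is a Baire space, being the continuous image of a pseudocompact one. So one
  translate, and therefore the closure itself, has interior points.\<close>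

lemma skeletal_map_rep:
  assumes Cp: "F \<subseteq> topspace (Cp X)"
    and invariant: "\<And>g f. \<lbrakk>g \<in> carrier G; f \<in> F\<rbrakk> \<Longrightarrow> right_action X \<theta> g f \<in> F"
  shows "skeletal_map X (func_quotient X F) (rep X F)"
  unfolding skeletal_map_def
proof (intro conjI allI impI)
  let ?Q = "func_quotient X F"
  show \<rho>: "continuous_map X ?Q (rep X F)"
    using Cp by (intro continuous_map_rep) (auto simp: in_topspace_Cp)
  fix U assume U: "openin X U \<and> U \<noteq> {}"
  define \<psi> where "\<psi> = (\<lambda>g y. rep X F (\<theta> g y))"
  have f_act: "f (\<theta> g x) = right_action X \<theta> g f x" if "x \<in> topspace X" for f g x
    using that by (simp add: right_action_def)
  have QX: "y \<in> topspace X" if "y \<in> topspace ?Q" for y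
    using subsetD[OF topspace_func_quotient_subset that] .
  have \<psi>_rep: "\<psi> g (rep X F x) = rep X F (\<theta> g x)" if "g \<in> carrier G" "x \<in> topspace X" for g x
    unfolding \<psi>_def
  proof (rule rep_eqI)
    fix f assume "f \<in> F"
    with that invariant have "right_action X \<theta> g f \<in> F"
      by blast
    then show "f (\<theta> g (rep X F x)) = f (\<theta> g x)"
      using that by (simp add: f_act rep_in_topspace rep_preserves)
  qed
  have \<psi>_continuous: "continuous_map ?Q ?Q (\<psi> g)" if g: "g \<in> carrier G" for g
    unfolding continuous_map_into_func_quotient
  proof (intro conjI ballI)
    show "\<psi> g \<in> topspace ?Q \<rightarrow> topspace ?Q"
      using act_closed[OF g] QX by (auto simp: \<psi>_def topspace_func_quotient)
    fix f assume f: "f \<in> F"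
    show "continuous_map ?Q euclideanreal (\<lambda>y. f (\<psi> g y))"
    proof (rule continuous_map_eq)
      show "continuous_map ?Q euclideanreal (right_action X \<theta> g f)"
        using invariant[OF g f] by (rule continuous_map_from_func_quotient)
      show "right_action X \<theta> g f y = f (\<psi> g y)" if "y \<in> topspace ?Q" for y
        using QX[OF that] rep_preserves[OF act_closed[OF g] f] by (simp add: \<psi>_def f_act)
    qed
  qed
  have \<psi>_inverse: "\<psi> h (\<psi> g y) = y"
    if "g \<in> carrier G" "h \<in> carrier G" "h \<otimes> g = \<one>" "y \<in> topspace ?Q" for g h y
  proof -
    have "\<psi> h (\<psi> g y) = rep X F (\<theta> h (\<theta> g y))"
      using \<psi>_rep[of h "\<theta> g y"] that QX act_closed by (simp add: \<psi>_def)
    also have "\<theta> h (\<theta> g y) = y"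
      using composition_rule[of y h g] that QX act_one by simp
    finally show ?thesis
      using that(4) by (simp add: rep_func_quotient)
  qed
  have \<psi>_homeo: "homeomorphic_map ?Q ?Q (\<psi> g)" if g: "g \<in> carrier G" for g
    unfolding homeomorphic_map_maps homeomorphic_maps_def
    using g by (intro exI[of _ "\<psi> (inv g)"]) (simp add: \<psi>_continuous \<psi>_inverse)
  obtain A where A: "A \<subseteq> carrier G" "countable A" "topspace X \<subseteq> (\<Union>a\<in>A. \<theta> a ` U)"
    using U countable_translates_cover by blast
  have "U \<subseteq> topspace X" "topspace X \<noteq> {}"
    using U openin_subset by blast+
  then have "A \<noteq> {}"
    using A(3) by auto
  have a: "from_nat_into A n \<in> carrier G" for n
    using A(1) from_nat_into[OF \<open>A \<noteq> {}\<close>] by blast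
  have image: "rep X F ` U \<subseteq> topspace ?Q"
    using \<open>U \<subseteq> topspace X\<close> by (auto simp: topspace_func_quotient)
  let ?C = "?Q closure_of (rep X F ` U)"
  have C: "?C \<subseteq> topspace ?Q"
    by (rule closure_of_subset_topspace)
  obtain n where "?Q interior_of (\<psi> (from_nat_into A n) ` ?C) \<noteq> {}"
  proof (rule pseudocompact_space_Baire)
    show "completely_regular_space ?Q"
      using Tychonoff_space_func_quotient[of X F] by (simp add: Tychonoff_space_def)
    show "pseudocompact_space ?Q"
      using pseudocompact \<rho> topspace_func_quotient[symmetric]
      by (rule pseudocompact_space_continuous_map_image)
    show "topspace ?Q \<noteq> {}"
      using \<open>topspace X \<noteq> {}\<close> by (simp add: topspace_func_quotient)
    show "closedin ?Q (\<psi> (from_nat_into A n) ` ?C)" for n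
      using homeomorphic_map_closedness[OF \<psi>_homeo[OF a] C] by simp
    show "topspace ?Q \<subseteq> (\<Union>n. \<psi> (from_nat_into A n) ` ?C)"
    proof
      fix y assume "y \<in> topspace ?Q"
      then obtain x where x: "x \<in> topspace X" "y = rep X F x"
        by (auto simp: topspace_func_quotient)
      then obtain b u where bu: "b \<in> A" "u \<in> U" "x = \<theta> b u"
        using A(3) by blast
      then have "b \<in> carrier G" "u \<in> topspace X"
        using A(1) \<open>U \<subseteq> topspace X\<close> by blast+
      then have "y = \<psi> b (rep X F u)"
        using \<psi>_rep bu(3) x(2) by simp
      moreover have "rep X F u \<in> ?C"
        using closure_of_subset[OF image] bu(2) by blast
      moreover obtain n where "b = from_nat_into A n"
        using from_nat_into_surj[OF A(2) bu(1)] by metis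
      ultimately show "y \<in> (\<Union>n. \<psi> (from_nat_into A n) ` ?C)"
        by blast
    qed
  qed
  then show "?Q interior_of ?C \<noteq> {}"
    using homeomorphic_map_interior_of[OF \<psi>_homeo[OF a] C] by simp
qed

text \<open>A countable dense subset \<open>D\<close> of \<open>E\<close> in the topology of pointwise convergence determines the
  values of all functions in \<open>E\<close>: two points at which all of \<open>D\<close> agree cannot be told apart by
  the closure of \<open>D\<close>. By pseudocompactness every function in \<open>E\<close> is then continuous in the
  values of \<open>D\<close>, so the new coordinates that \<open>E\<close> contributes amount to a map into a single
  copy of the countable power of the real line.\<close>

lemma metrizable_kernel_adjoin_separable:
  assumes Cp: "E \<subseteq> topspace (Cp X)" "E \<noteq> {}" and sep: "separable_space (subtopology (Cp X) E)"
  shows "metrizable_kernel (func_quotient X (F \<union> E)) (func_quotient X F) (rep X F)"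
proof -
  let ?Q = "func_quotient X (F \<union> E)" and ?Q' = "func_quotient X F"
  have E: "topspace (subtopology (Cp X) E) = E"
    using Cp(1) by auto
  obtain D where D: "countable D" "D \<subseteq> E" "subtopology (Cp X) E closure_of D = E"
    using sep unfolding separable_space_def E by blast
  have "D \<noteq> {}"
    using D(3) Cp(2) by auto
  define d where "d = from_nat_into D"
  have dE: "d n \<in> E" for n
    using from_nat_into[OF \<open>D \<noteq> {}\<close>] D(2) unfolding d_def by blast
  define m where "m = (\<lambda>x n. d n x)"
  have m_into: "continuous_map Z euclidean m"
    if "\<And>n. continuous_map Z euclideanreal (d n)" for Z
    using that unfolding m_def by (simp add: continuous_map_componentwise_UNIV flip: euclidean_product_topology)
  have mX: "continuous_map X euclidean m"
    using dE Cp(1) in_topspace_Cp by (intro m_into) blast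
  have eval: "continuous_map (subtopology (Cp X) E) euclideanreal (\<lambda>h. h z)" if "z \<in> topspace X" for z
    unfolding Cp_def using that by (intro continuous_map_from_subtopology continuous_map_product_projection)
  have fibre: "f x = f y" if f: "f \<in> E" and xy: "x \<in> topspace X" "y \<in> topspace X" "m x = m y" for f x y
  proof (rule forall_in_closure_of_eq[where Y = euclideanreal and f = "\<lambda>h. h x"])
    show "f \<in> subtopology (Cp X) E closure_of D"
      using f D(3) by simp
    show "continuous_map (subtopology (Cp X) E) euclideanreal (\<lambda>h. h x)"
      "continuous_map (subtopology (Cp X) E) euclideanreal (\<lambda>h. h y)"
      using xy by (simp_all add: eval)
    fix h assume "h \<in> D"
    then obtain n where "h = d n"
      using from_nat_into_surj[OF D(1)] unfolding d_def by metis
    then show "h x = h y"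
      using fun_cong[OF xy(3), of n] by (simp add: m_def)
  qed simp
  define e where "e = (\<lambda>y. (rep X F y, m y))"
  have "embedding_map ?Q (prod_topology ?Q' euclidean) e"
  proof (rule embedding_map_from_func_quotient)
    have "continuous_map ?Q euclidean m"
      using dE by (intro m_into continuous_map_from_func_quotient) blast
    then show "continuous_map ?Q (prod_topology ?Q' euclidean) e"
      unfolding e_def continuous_map_pairwise comp_def
      by (simp add: continuous_map_rep_func_quotient)
    let ?E = "subtopology (prod_topology ?Q' euclidean) (e ` topspace ?Q)"
    have QX: "y \<in> topspace X" if "y \<in> topspace ?Q" for y
      using subsetD[OF topspace_func_quotient_subset that] .
    fix f assume "f \<in> F \<union> E"
    then consider "f \<in> F" | "f \<in> E" by blast
    then show "\<exists>g. continuous_map ?E euclideanreal g \<and> (\<forall>y\<in>topspace ?Q. g (e y) = f y)"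
    proof cases
      case 1
      have "continuous_map ?E euclideanreal (f \<circ> fst)"
        using continuous_map_from_func_quotient[OF 1]
        by (intro continuous_map_compose[of _ ?Q'] continuous_map_from_subtopology continuous_map_fst)
      moreover have "(f \<circ> fst) (e y) = f y" if "y \<in> topspace ?Q" for y
        using rep_preserves[OF QX[OF that] 1] by (simp add: e_def)
      ultimately show ?thesis by blast
    next
      case 2
      have f: "continuous_map X euclideanreal f"
        using 2 Cp(1) in_topspace_Cp by blast
      then obtain g where g: "continuous_on (m ` topspace X) g" "\<And>x. x \<in> topspace X \<Longrightarrow> g (m x) = f x"
        using pseudocompact_space_factor_through_metric[OF pseudocompact mX f fibre] 2 by blast
      have "snd ` e ` topspace ?Q \<subseteq> m ` topspace X"
        using QX by (auto simp: e_def)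
      then have "continuous_map ?E (top_of_set (m ` topspace X)) snd"
        by (auto simp: continuous_map_in_subtopology intro!: continuous_map_from_subtopology continuous_map_snd)
      then have "continuous_map ?E euclideanreal (g \<circ> snd)"
        using g(1) by (intro continuous_map_compose) auto
      moreover have "(g \<circ> snd) (e y) = f y" if "y \<in> topspace ?Q" for y
        using g(2)[OF QX[OF that]] by (simp add: e_def)
      ultimately show ?thesis by blast
    qed
  qed
  moreover have "separable_space (euclidean :: (nat \<Rightarrow> real) topology)"
  proof -
    obtain B :: "(nat \<Rightarrow> real) set"
      where B: "countable B" "\<And>U. open U \<Longrightarrow> U \<noteq> {} \<Longrightarrow> \<exists>b\<in>B. b \<in> U"
      using countable_dense_exists by blast
    have "v \<in> euclidean closure_of B" for v
      unfolding in_closure_of open_openin[symmetric] using B(2) by auto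
    then show ?thesis
      using B(1) unfolding separable_space_def by (intro exI[of _ B]) auto
  qed
  ultimately show ?thesis
    unfolding metrizable_kernel_def
    by (intro exI[of _ euclidean] exI[of _ e]) (simp add: metrizable_space_euclidean e_def)
qed

end

section \<open>The tower generated by an enumeration of the continuous functions\<close>

text \<open>Because of this, a cardinal order of the type of indices has no last element, so every
  function in the enumeration used below is absorbed at some later stage.\<close>

lemma infinite_UNIV_sets_of_functions: "infinite (UNIV :: ('a \<Rightarrow> real) set set)"
proof
  assume fin: "finite (UNIV :: ('a \<Rightarrow> real) set set)"
  have "inj (\<lambda>c::real. {\<lambda>_::'a. c})"
    by (auto simp: inj_def fun_eq_iff)
  then have "finite (UNIV :: real set)"
    using fin by (rule inj_on_finite[OF _ subset_UNIV])
  then show False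
    using infinite_UNIV_char_0 by blast
qed

theorem theorem1p5:
  fixes X :: "'a topology"
    and G :: "('g, 'm) monoid_scheme"
    and T :: "'g topology"
    and \<theta> :: "'g \<Rightarrow> 'a \<Rightarrow> 'a"
  assumes "Tychonoff_space X"
    and "pseudocompact_space X"
    and "semitopological_group G T"
    and "Tychonoff_space T"
    and "omega_narrow G T"
    and "separately_continuous_action G T X \<theta>"
    and "transitive_action G (topspace X) \<theta>"
    and "s_action G X \<theta>"
  shows "skeletally_Dugundji X"
proof -
  interpret semitopological_group G T by fact
  interpret transitive_action G "topspace X" \<theta> by fact
  interpret narrow_transitive_action G X \<theta> T
    using assms(2,5,6) topspace_eq
    by unfold_locales (auto simp: separately_continuous_action_def)
  define r where "r = card_of (UNIV :: ('a \<Rightarrow> real) set set)"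
  have r: "Card_order r" "Field r = UNIV"
    unfolding r_def by (rule card_of_Card_order, rule Field_card_of)
  have wo: "Well_order r"
    unfolding r_def by (rule card_of_Well_order)
  have total: "\<beta> \<in> underS r \<alpha>" if "(\<alpha>, \<beta>) \<notin> r" for \<alpha> \<beta>
    using underS_if_not_le[OF wo] that r(2) by blast
  let ?O = "\<lambda>f. (\<lambda>g. right_action X \<theta> g f) ` carrier G"
  \<comment> \<open>The singletons enumerate the continuous functions; the remaining indices repeat a constant.\<close>
  define c where "c = (\<lambda>i. if the_elem i \<in> topspace (Cp X) then the_elem i else (\<lambda>x\<in>topspace X. 0 :: real))"
  have c_Cp: "c i \<in> topspace (Cp X)" for i
    unfolding c_def by (simp add: restrict_in_topspace_Cp)
  have c_surj: "c {f} = f" if "f \<in> topspace (Cp X)" for f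
    using that by (simp add: c_def)
  \<comment> \<open>Adjoining whole orbits keeps every stage invariant; taking only the indices strictly
    below \<open>\<beta>\<close> makes the first stage empty, limit stages unions of the
    earlier ones, and lets each successor stage add exactly one orbit.\<close>
  define F where "F = (\<lambda>\<beta>. \<Union>\<gamma>\<in>underS r \<beta>. ?O (c \<gamma>))"
  have F_Cp: "F \<beta> \<subseteq> topspace (Cp X)" for \<beta>
    using right_action_in_Cp c_Cp by (auto simp: F_def)
  have F_invariant: "right_action X \<theta> g f \<in> F \<beta>" if "g \<in> carrier G" "f \<in> F \<beta>" for g f \<beta>
    using that right_action_right_action by (fastforce simp: F_def)
  interpret function_tower X r F
  proof
    show "Well_order r" by (rule wo)
    show "continuous_map X euclideanreal f" if "f \<in> F \<alpha>" for f \<alpha>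
      using that F_Cp in_topspace_Cp by blast
    show "F \<alpha> \<subseteq> F \<beta>" if "\<alpha> \<in> underS r \<beta>" for \<alpha> \<beta>
      unfolding F_def using underS_trans[OF wo _ that] by blast
  qed
  have "skeletally_Dugundji_system X r S bond"
  proof (rule skeletally_Dugundji_system_S)
    show "Tychonoff_space X" by fact
    show "Card_order r" by (rule r)
    show "Field r \<noteq> {}" by (simp add: r)
    show "F \<alpha> = {}" if "underS r \<alpha> = {}" for \<alpha>
      by (simp add: F_def that)
    show "metrizable_kernel (S \<beta>) (S \<alpha>) (rep X (F \<alpha>))" if "is_successor r \<alpha> \<beta>" for \<alpha> \<beta>
    proof -
      have "\<gamma> = \<alpha> \<or> \<gamma> \<in> underS r \<alpha>" if "\<gamma> \<in> underS r \<beta>" for \<gamma>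
        using that \<open>is_successor r \<alpha> \<beta>\<close> unfolding is_successor_def underS_def by blast
      then have "underS r \<beta> = insert \<alpha> (underS r \<alpha>)"
        using \<open>is_successor r \<alpha> \<beta>\<close> underS_trans[OF wo] unfolding is_successor_def by blast
      then have F\<beta>: "F \<beta> = F \<alpha> \<union> ?O (c \<alpha>)"
        by (auto simp: F_def)
      show ?thesis
        unfolding F\<beta>
      proof (rule metrizable_kernel_adjoin_separable)
        show "?O (c \<alpha>) \<subseteq> topspace (Cp X)"
          using right_action_in_Cp c_Cp by blast
        show "?O (c \<alpha>) \<noteq> {}"
          using one_closed by blast
        show "separable_space (subtopology (Cp X) (?O (c \<alpha>)))"
          using assms(8) c_Cp unfolding s_action_def by blast
      qed
    qed
    show "F \<gamma> \<subseteq> (\<Union>\<alpha>\<in>underS r \<gamma>. F \<alpha>)" if "is_limit r \<gamma>" for \<gamma>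
    proof
      fix f assume "f \<in> F \<gamma>"
      then obtain \<delta> where \<delta>: "\<delta> \<in> underS r \<gamma>" "f \<in> ?O (c \<delta>)"
        by (auto simp: F_def)
      moreover have "\<not> is_successor r \<delta> \<gamma>"
        using that by (simp add: is_limit_def)
      ultimately obtain \<alpha> where "\<alpha> \<in> underS r \<gamma>" "(\<alpha>, \<delta>) \<notin> r"
        unfolding is_successor_def by blast
      then show "f \<in> (\<Union>\<alpha>\<in>underS r \<gamma>. F \<alpha>)"
        using total \<delta>(2) unfolding F_def by blast
    qed
    show "topspace (Cp X) = (\<Union>\<alpha>\<in>Field r. F \<alpha>)"
    proof
      show "topspace (Cp X) \<subseteq> (\<Union>\<alpha>\<in>Field r. F \<alpha>)"
      proof
        fix f assume f: "f \<in> topspace (Cp X)"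
        obtain \<beta> where "{f} \<in> underS r \<beta>"
          using infinite_Card_order_limit[OF r(1), of "{f}"] infinite_UNIV_sets_of_functions
          unfolding r(2) underS_def by blast
        moreover have "f \<in> ?O (c {f})"
          using right_action_one[OF f] one_closed unfolding c_surj[OF f] by (metis imageI)
        ultimately show "f \<in> (\<Union>\<alpha>\<in>Field r. F \<alpha>)"
          unfolding r(2) F_def by blast
      qed
    qed (use F_Cp in blast)
    show "skeletal_map X (S \<alpha>) (rep X (F \<alpha>))" for \<alpha>
      using F_Cp F_invariant by (rule skeletal_map_rep)
  qed
  then show ?thesis
    unfolding skeletally_Dugundji_def by blast
qed

end
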